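(* Let $N\ge 2$, let $\alpha_1,\ldots,\alpha_N\in\mathbb Z$ with $\alpha_1>\alpha_2>\cdots>\alpha_N$, and set $$\mathcal U=\{(n_1,\ldots,n_N)\in\mathbb Z^N \mid -\alpha_1\le n_1\le-\alpha_2\le n_2\le\cdots\le-\alpha_N\le n_N\}.$$ Let $\epsilon_1,\ldots,\epsilon_N\in\mathbb R$ and let $x_k:\mathcal U\to[0,\infty)$, $k=1,\ldots,N$, be $N$ independent separable solutions of the discrete Euler-Poisson-Darboux system with parameter $\gamma=\tfrac12$ and shifts $\epsilon_1,\dots,\epsilon_N$ (the same for all $k$), defined on $\mathcal U$ and satisfying the boundary conditions $$x_k|_{n_k=-\alpha_k}=0\quad (k=1,\ldots,N),\qquad x_k|_{n_{k-1}=-\alpha_k}=0\quad (k=2,\ldots,N),$$ and such that $x_k>0$ at all points of $\mathcal U$ at which these boundary conditions do not prescribe $x_k=0$. Then $$\epsilon_i-\epsilon_j=\frac{j-i}{2}\quad\text{for } i,j=1,\ldots,N,$$ and there are constants $D_1,\ldots,D_N>0$ such that for all $k$ and all $(n_1,\dots,n_N)\in\mathcal U$ $$x_k(n_1,\ldots,n_N)=D_k\prod_{i=1}^N\rho_i^{(k)}(n_i),$$ where $$\rho_i^{(k)}(n_i)=\begin{cases}\left(n_i+\alpha_k+\frac{k-i}{2}\right)_{1/2}& \text{for } i\ge k,\\[4pt] \left(-n_i-\alpha_k-\frac{k-i}{2}+\frac12\right)_{1/2}&\text{for } i<k.\end{cases}$$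
   Context: For a function $f$ on (a subset of) $\mathbb Z^N$, $\Delta_i f(n)=f(n+e_i)-f(n)$, with $e_i$ the $i$-th coordinate vector. A function $x$ satisfies the discrete Euler-Poisson-Darboux system with parameter $\gamma\in\mathbb R$ and shifts $\epsilon_1,\ldots,\epsilon_N\in\mathbb R$ if for all $i\ne j$ $$\Delta_i\Delta_j x=\frac{\gamma}{n_i+\epsilon_i-n_j-\epsilon_j}\,(\Delta_j x-\Delta_i x)$$ at every $n$ such that $n,\,n+e_i,\,n+e_j,\,n+e_i+e_j$ all lie in the domain (the denominators are tacitly nonzero there). A function $x$ is separable if $x(n_1,\ldots,n_N)=\rho_1(n_1)\cdots\rho_N(n_N)$ for some functions $\rho_i$ of one variable. The discrete square root function is $(u)_{1/2}=\Gamma(u+\tfrac12)/\Gamma(u)$ for $u>0$, and $(0)_{1/2}=0$ (since $1/\Gamma(0)=0$). *)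

theory Defs
  imports "HOL-Analysis.Analysis"
begin

text \<open>Points of \<open>\<int>\<^sup>N\<close> are extensional functions on \<open>{1..N}\<close>, that is, elements of
  \<open>{1..N} \<rightarrow>\<^sub>E UNIV\<close>. A function on a subset of \<open>\<int>\<^sup>N\<close> is a total function on this type
  of which only the values on that subset matter.\<close>

definition lattice_shift :: "nat \<Rightarrow> (nat \<Rightarrow> int) \<Rightarrow> nat \<Rightarrow> int" where
  "lattice_shift i n = n(i := n i + 1)"

definition partial_diff :: "nat \<Rightarrow> ((nat \<Rightarrow> int) \<Rightarrow> real) \<Rightarrow> (nat \<Rightarrow> int) \<Rightarrow> real" where
  "partial_diff i f n = f (lattice_shift i n) - f n"

text \<open>That the denominators do not vanish is part of being a solution; without this
  conjunct the convention \<open>a / 0 = 0\<close> would give the equation an unintended meaning.\<close>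

definition discrete_EPD ::
    "nat \<Rightarrow> (nat \<Rightarrow> int) set \<Rightarrow> real \<Rightarrow> (nat \<Rightarrow> real) \<Rightarrow> ((nat \<Rightarrow> int) \<Rightarrow> real) \<Rightarrow> bool" where
  "discrete_EPD N U \<gamma> \<epsilon> x \<longleftrightarrow>
     (\<forall>i\<in>{1..N}. \<forall>j\<in>{1..N}. i \<noteq> j \<longrightarrow>
       (\<forall>n. n \<in> U \<and> lattice_shift i n \<in> U \<and> lattice_shift j n \<in> U \<and>
            lattice_shift i (lattice_shift j n) \<in> U \<longrightarrow>
          n i + \<epsilon> i - n j - \<epsilon> j \<noteq> 0 \<and>
          partial_diff i (partial_diff j x) n =
            \<gamma> / (n i + \<epsilon> i - n j - \<epsilon> j) * (partial_diff j x n - partial_diff i x n)))"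

definition separable_on :: "nat \<Rightarrow> (nat \<Rightarrow> int) set \<Rightarrow> ((nat \<Rightarrow> int) \<Rightarrow> real) \<Rightarrow> bool" where
  "separable_on N U x \<longleftrightarrow>
     (\<exists>\<rho> :: nat \<Rightarrow> int \<Rightarrow> real. \<forall>n\<in>U. x n = (\<Prod>i=1..N. \<rho> i (n i)))"

text \<open>Linear independence of the family \<open>x 1, \<dots>, x N\<close> of real functions restricted to \<open>U\<close>.\<close>

definition lin_indep_on ::
    "nat \<Rightarrow> (nat \<Rightarrow> int) set \<Rightarrow> (nat \<Rightarrow> (nat \<Rightarrow> int) \<Rightarrow> real) \<Rightarrow> bool" where
  "lin_indep_on N U x \<longleftrightarrow>
     (\<forall>c :: nat \<Rightarrow> real. (\<forall>n\<in>U. (\<Sum>k=1..N. c k * x k n) = 0) \<longrightarrow> (\<forall>k\<in>{1..N}. c k = 0))"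

definition conf_domain :: "nat \<Rightarrow> (nat \<Rightarrow> int) \<Rightarrow> (nat \<Rightarrow> int) set" where
  "conf_domain N \<alpha> =
     {n \<in> {1..N} \<rightarrow>\<^sub>E UNIV.
        (\<forall>i\<in>{1..N}. - \<alpha> i \<le> n i) \<and> (\<forall>i\<in>{1..<N}. n i \<le> - \<alpha> (i + 1))}"

text \<open>The points at which the boundary conditions prescribe \<open>x k = 0\<close>.\<close>

definition conf_boundary :: "(nat \<Rightarrow> int) \<Rightarrow> nat \<Rightarrow> (nat \<Rightarrow> int) \<Rightarrow> bool" where
  "conf_boundary \<alpha> k n \<longleftrightarrow> n k = - \<alpha> k \<or> (2 \<le> k \<and> n (k - 1) = - \<alpha> k)"

text \<open>The discrete square root is only considered for \<open>u \<ge> 0\<close>; the value \<open>0\<close> at negative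
  arguments is a dummy.\<close>

definition discrete_sqrt :: "real \<Rightarrow> real" where
  "discrete_sqrt u = (if u > 0 then Gamma (u + 1/2) / Gamma u else 0)"

end

theory Submission
  imports Defs
begin

text \<open>The domain is a product of integer intervals, and away from its prescribed zeros \<open>x k\<close>
  is positive. Hence the system decouples into equations between two factors \<open>\<rho> i\<close>, \<open>\<rho> j\<close>.
  At \<open>n k = - \<alpha> k\<close> the factor \<open>\<rho> k\<close> vanishes, and the equation for the pair \<open>(k, j)\<close> becomes a
  first-order recurrence for \<open>\<rho> j\<close>. Substituting it into the equation at a general \<open>n k\<close> gives
  the same kind of recurrence for \<open>\<rho> k\<close>. These are the recurrences satisfied by the discrete
  square root, so all factors are determined up to constants. The second boundary condition,
  \<open>\<rho> (k - 1) (- \<alpha> k) = 0\<close>, forces \<open>\<epsilon> (k - 1) - \<epsilon> k = 1/2\<close>.\<close>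

section \<open>The discrete square root and first-order recurrences\<close>

lemma discrete_sqrt_pos: "u > 0 \<Longrightarrow> discrete_sqrt u > 0"
  by (simp add: discrete_sqrt_def Gamma_real_pos)

text \<open>Follows from \<open>Gamma (z + 1) = z * Gamma z\<close> in numerator and denominator.
  Multiplying out keeps \<open>u = 0\<close>, where \<open>Gamma u\<close> has a pole: there both
  sides vanish.\<close>

lemma discrete_sqrt_plus1:
  assumes "u \<ge> 0"
  shows "u * discrete_sqrt (u + 1) = (u + 1/2) * discrete_sqrt u"
proof (cases "u = 0")
  case True
  then show ?thesis by (simp add: discrete_sqrt_def)
next
  case False
  with assms have u: "u > 0" by simp
  have "Gamma (u + 1) = u * Gamma u"
    using u by (intro Gamma_plus1) (auto dest: nonpos_Ints_nonpos)
  moreover have "Gamma (u + 1 + 1/2) = (u + 1/2) * Gamma (u + 1/2)"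
    using u Gamma_plus1[of "u + 1/2"] nonpos_Ints_nonpos[of "u + 1/2"]
    by (fastforce simp: add_ac)
  moreover have "discrete_sqrt (u + 1) = Gamma (u + 1 + 1/2) / Gamma (u + 1)"
    using u by (simp add: discrete_sqrt_def)
  ultimately have "discrete_sqrt (u + 1) = (u + 1/2) * Gamma (u + 1/2) / (u * Gamma u)"
    by simp
  then show ?thesis
    using u by (simp add: discrete_sqrt_def)
qed

text \<open>As long as \<open>p\<close> does not vanish, each value determines the next, so two
  solutions are proportional. Zeros of \<open>q\<close> are harmless: \<open>g\<close> has to be
  nonzero only at the starting point.\<close>

lemma first_order_recurrence_unique:
  fixes f g p q :: "int \<Rightarrow> real"
  assumes "a \<le> s" and "g a \<noteq> 0"
    and "\<And>t. a \<le> t \<Longrightarrow> t < s \<Longrightarrow> p t \<noteq> 0"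
    and "\<And>t. a \<le> t \<Longrightarrow> t < s \<Longrightarrow> p t * f (t + 1) = q t * f t"
    and "\<And>t. a \<le> t \<Longrightarrow> t < s \<Longrightarrow> p t * g (t + 1) = q t * g t"
  shows "f s = f a / g a * g s"
  using assms
proof (induction s rule: int_ge_induct)
  case base
  then show ?case by simp
next
  case (step s)
  have IH: "f s = f a / g a * g s" using step by simp
  have p: "p s \<noteq> 0" using step by simp
  have "p s * f (s + 1) = f a / g a * (q s * g s)"
    using step.prems(3)[of s] step.hyps by (simp add: IH)
  also have "\<dots> = p s * (f a / g a * g (s + 1))"
    using step.prems(4)[of s] step.hyps by simp
  finally show ?case using p by (simp only: mult_cancel_left) simp
qed

text \<open>A strict drop between integers is at least 1. This is what later keeps the arguments of
  the discrete square root nonnegative.\<close>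

lemma strict_antimono_on_int_gap:
  fixes \<alpha> :: "nat \<Rightarrow> int"
  assumes "strict_antimono_on {1..N} \<alpha>" and "1 \<le> i" and "i \<le> j" and "j \<le> N"
  shows "\<alpha> j + int j \<le> \<alpha> i + int i"
  using assms(3,4)
proof (induction j rule: dec_induct)
  case (step j)
  have "\<alpha> j > \<alpha> (Suc j)"
    using monotone_onD[OF assms(1), of j "Suc j"] assms(2) step by simp
  then show ?case using step by simp
qed simp

section \<open>The domain as a product of integer intervals\<close>

definition conf_range :: "nat \<Rightarrow> (nat \<Rightarrow> int) \<Rightarrow> nat \<Rightarrow> int set" where
  "conf_range N \<alpha> i = {s. - \<alpha> i \<le> s \<and> (i < N \<longrightarrow> s \<le> - \<alpha> (i + 1))}"

lemma conf_domain_iff: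
  "n \<in> conf_domain N \<alpha> \<longleftrightarrow>
     n \<in> {1..N} \<rightarrow>\<^sub>E UNIV \<and> (\<forall>i\<in>{1..N}. n i \<in> conf_range N \<alpha> i)"
  by (auto simp: conf_domain_def conf_range_def)

lemma conf_domain_upd:
  assumes "n \<in> conf_domain N \<alpha>" "i \<in> {1..N}" "s \<in> conf_range N \<alpha> i"
  shows "n(i := s) \<in> conf_domain N \<alpha>"
  using assms by (auto simp: conf_domain_iff PiE_def extensional_def)

section \<open>Factors of a single separable solution\<close>

locale separable_EPD_solution =
  fixes N :: nat and \<alpha> :: "nat \<Rightarrow> int" and \<epsilon> :: "nat \<Rightarrow> real" and k :: nat
    and y :: "(nat \<Rightarrow> int) \<Rightarrow> real" and \<rho> :: "nat \<Rightarrow> int \<Rightarrow> real"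
  assumes N: "N \<ge> 2"
    and anti: "strict_antimono_on {1..N} \<alpha>"
    and k: "k \<in> {1..N}"
    and sep: "\<And>n. n \<in> conf_domain N \<alpha> \<Longrightarrow> y n = (\<Prod>i=1..N. \<rho> i (n i))"
    and EPD: "discrete_EPD N (conf_domain N \<alpha>) (1/2) \<epsilon> y"
    and bdry: "\<And>n. n \<in> conf_domain N \<alpha> \<Longrightarrow> conf_boundary \<alpha> k n \<Longrightarrow> y n = 0"
    and pos: "\<And>n. n \<in> conf_domain N \<alpha> \<Longrightarrow> \<not> conf_boundary \<alpha> k n \<Longrightarrow> y n > 0"
begin

lemma alpha_decreasing: "1 \<le> i \<Longrightarrow> i < N \<Longrightarrow> \<alpha> (Suc i) < \<alpha> i"
  using strict_antimono_on_int_gap[OF anti, of i "Suc i"] by simp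

text \<open>A reference point where \<open>y\<close> is positive: every coordinate is at its lower
  end, except that coordinate \<open>k\<close> moves one step off its prescribed zero. All factors
  are nonzero here and can be cancelled.\<close>

definition base :: "nat \<Rightarrow> int" where
  "base = (\<lambda>i\<in>{1..N}. if i = k then - \<alpha> k + 1 else - \<alpha> i)"

lemma base_in: "base \<in> conf_domain N \<alpha>"
proof -
  have "base i \<in> conf_range N \<alpha> i" if "i \<in> {1..N}" for i
    using that alpha_decreasing[of i] by (auto simp: base_def conf_range_def)
  then show ?thesis by (simp add: conf_domain_iff base_def)
qed

lemma base_range: "i \<in> {1..N} \<Longrightarrow> base i \<in> conf_range N \<alpha> i"
  using base_in by (simp add: conf_domain_iff)

lemma base_not_boundary: "\<not> conf_boundary \<alpha> k base"
proof -
  have "2 \<le> k \<Longrightarrow> \<alpha> k < \<alpha> (k - 1)"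
    using alpha_decreasing[of "k - 1"] k by simp
  then show ?thesis using k by (auto simp: conf_boundary_def base_def)
qed

lemma factor_base_nonzero: "i \<in> {1..N} \<Longrightarrow> \<rho> i (base i) \<noteq> 0"
  using pos[OF base_in base_not_boundary] sep[OF base_in] by (metis finite_atLeastAtMost less_irrefl prod_zero_iff)

lemma sep_upd:
  assumes "i \<in> {1..N}" "s \<in> conf_range N \<alpha> i"
  shows "y (base(i := s)) = \<rho> i s * (\<Prod>l\<in>{1..N}-{i}. \<rho> l (base l))"
  using assms by (simp add: sep conf_domain_upd base_in prod.remove[of _ i])

lemma sep_upd2:
  assumes "i \<in> {1..N}" "j \<in> {1..N}" "i \<noteq> j" "s \<in> conf_range N \<alpha> i" "t \<in> conf_range N \<alpha> j"
  shows "y (base(i := s, j := t)) =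
    \<rho> i s * \<rho> j t * (\<Prod>l\<in>{1..N}-{i}-{j}. \<rho> l (base l))"
proof -
  have split: "(\<Prod>l=1..N. f l) = f i * (f j * (\<Prod>l\<in>{1..N}-{i}-{j}. f l))"
    for f :: "nat \<Rightarrow> real"
    using assms prod.remove[of "{1..N}" i f] prod.remove[of "{1..N}-{i}" j f] by simp
  have "y (base(i := s, j := t)) = (\<Prod>l=1..N. \<rho> l ((base(i := s, j := t)) l))"
    using assms by (intro sep conf_domain_upd base_in)
  also have "\<dots> = \<rho> i s * (\<rho> j t *
      (\<Prod>l\<in>{1..N}-{i}-{j}. \<rho> l ((base(i := s, j := t)) l)))"
    unfolding split using assms(3) by simp
  also have "(\<Prod>l\<in>{1..N}-{i}-{j}. \<rho> l ((base(i := s, j := t)) l)) =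
      (\<Prod>l\<in>{1..N}-{i}-{j}. \<rho> l (base l))"
    by (rule prod.cong) auto
  finally show ?thesis by (simp only: mult.assoc)
qed

text \<open>If only coordinate \<open>i\<close> of \<open>base\<close> is changed, the other factors
  stay nonzero, so \<open>\<rho> i s\<close> vanishes exactly when \<open>y\<close> does, and the
  boundary and positivity conditions decide that.\<close>

lemma factor_eq_0_iff:
  assumes "i \<in> {1..N}" "s \<in> conf_range N \<alpha> i"
  shows "\<rho> i s = 0 \<longleftrightarrow> (i = k \<or> Suc i = k) \<and> s = - \<alpha> k"
proof -
  have R: "(\<Prod>l\<in>{1..N}-{i}. \<rho> l (base l)) \<noteq> 0"
    using factor_base_nonzero by (auto simp: prod_zero_iff)
  have mem: "base(i := s) \<in> conf_domain N \<alpha>"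
    using assms by (intro conf_domain_upd base_in)
  have "y (base(i := s)) = 0 \<longleftrightarrow> conf_boundary \<alpha> k (base(i := s))"
    using bdry[OF mem] pos[OF mem] by force
  also have "\<dots> \<longleftrightarrow> (i = k \<or> Suc i = k) \<and> s = - \<alpha> k"
    using base_not_boundary assms by (auto simp: conf_boundary_def)
  finally show ?thesis using R by (simp add: sep_upd[OF assms])
qed

text \<open>The system is evaluated at points that differ from \<open>base\<close> only in
  coordinates \<open>i\<close> and \<open>j\<close>; the product \<open>R\<close> of the remaining
  factors is nonzero and cancels.\<close>

lemma pair_equation:
  assumes ij: "i \<in> {1..N}" "j \<in> {1..N}" "i \<noteq> j"
    and st: "s \<in> conf_range N \<alpha> i" "s + 1 \<in> conf_range N \<alpha> i"
      "t \<in> conf_range N \<alpha> j" "t + 1 \<in> conf_range N \<alpha> j"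
  defines "d \<equiv> s + \<epsilon> i - t - \<epsilon> j"
  shows "d \<noteq> 0"
    and "d * (\<rho> i (s + 1) - \<rho> i s) * (\<rho> j (t + 1) - \<rho> j t) =
      (\<rho> i s * \<rho> j (t + 1) - \<rho> i (s + 1) * \<rho> j t) / 2"
proof -
  define R where "R = (\<Prod>l\<in>{1..N}-{i}-{j}. \<rho> l (base l))"
  have R: "R \<noteq> 0"
    using factor_base_nonzero by (auto simp: R_def prod_zero_iff)
  define n where "n = base(i := s, j := t)"
  \<comment> \<open>Both orders of the double shift are needed: the system asks for membership of
    one, and unfolding the iterated difference produces the other.\<close>
  have sh: "lattice_shift i n = base(i := s + 1, j := t)"
    "lattice_shift j n = base(i := s, j := t + 1)"
    "lattice_shift i (lattice_shift j n) = base(i := s + 1, j := t + 1)"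
    "lattice_shift j (lattice_shift i n) = base(i := s + 1, j := t + 1)"
    using ij by (auto simp: lattice_shift_def n_def fun_upd_twist)
  have mem: "base(i := s', j := t') \<in> conf_domain N \<alpha>"
    if "s' \<in> conf_range N \<alpha> i" "t' \<in> conf_range N \<alpha> j" for s' t'
    using that ij by (intro conf_domain_upd base_in)
  have nij: "n i = s" "n j = t" using ij by (auto simp: n_def)
  have main: "d \<noteq> 0 \<and> partial_diff i (partial_diff j y) n =
      1/2 / d * (partial_diff j y n - partial_diff i y n)"
  proof -
    have "n \<in> conf_domain N \<alpha>" "lattice_shift i n \<in> conf_domain N \<alpha>"
      "lattice_shift j n \<in> conf_domain N \<alpha>"
      "lattice_shift i (lattice_shift j n) \<in> conf_domain N \<alpha>"
      unfolding sh(3) unfolding sh(1,2) by (simp_all only: n_def mem st)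
    with EPD[unfolded discrete_EPD_def, rule_format, OF ij, of n] show ?thesis
      by (simp only: d_def nij) simp
  qed
  then show d: "d \<noteq> 0" by simp
  note Y = sep_upd2[OF ij, folded R_def]
  from main have "y (base(i := s + 1, j := t + 1)) - y (base(i := s + 1, j := t))
      - (y (base(i := s, j := t + 1)) - y (base(i := s, j := t))) =
      1/2 / d * (y (base(i := s, j := t + 1)) - y (base(i := s + 1, j := t)))"
    by (simp add: partial_diff_def sh(1,2)) (simp add: n_def sh(4)[unfolded sh(1)])
  then have "R * (d * (\<rho> i (s + 1) - \<rho> i s) * (\<rho> j (t + 1) - \<rho> j t)) =
      R * ((\<rho> i s * \<rho> j (t + 1) - \<rho> i (s + 1) * \<rho> j t) / 2)"
    using d st by (simp add: Y field_simps)
  then show "d * (\<rho> i (s + 1) - \<rho> i s) * (\<rho> j (t + 1) - \<rho> j t) =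
      (\<rho> i s * \<rho> j (t + 1) - \<rho> i (s + 1) * \<rho> j t) / 2"
    using R by (simp only: mult_cancel_left) simp
qed

section \<open>Recurrences for the factors and the differences of the shifts\<close>

lemma lower_range:
  "i \<in> {1..N} \<Longrightarrow> - \<alpha> i \<in> conf_range N \<alpha> i" "i \<in> {1..N} \<Longrightarrow> - \<alpha> i + 1 \<in> conf_range N \<alpha> i"
  using alpha_decreasing[of i] by (auto simp: conf_range_def)

text \<open>At \<open>t = - \<alpha> k\<close> the pair equation loses every term containing
  \<open>\<rho> k t\<close>, and the nonzero value \<open>\<rho> k (t + 1)\<close> cancels from the
  rest. Here \<open>u\<close> is the denominator of the system, hence nonzero.\<close>

lemma factor_recurrence_other:
  assumes "i \<in> {1..N}" "i \<noteq> k" "s \<in> conf_range N \<alpha> i" "s + 1 \<in> conf_range N \<alpha> i"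
  defines "u \<equiv> s + \<epsilon> i + \<alpha> k - \<epsilon> k"
  shows "u \<noteq> 0" and "u * \<rho> i (s + 1) = (u + 1/2) * \<rho> i s"
proof -
  have k_end: "\<rho> k (- \<alpha> k) = 0" "\<rho> k (- \<alpha> k + 1) \<noteq> 0"
    using factor_eq_0_iff[OF k] lower_range[OF k] by auto
  show "u \<noteq> 0"
    using pair_equation(1)[OF assms(1) k assms(2-4) lower_range[OF k]] by (simp add: u_def)
  have "u * (\<rho> i (s + 1) - \<rho> i s) * \<rho> k (- \<alpha> k + 1) = \<rho> i s * \<rho> k (- \<alpha> k + 1) / 2"
    using pair_equation(2)[OF assms(1) k assms(2-4) lower_range[OF k]] k_end
    by (simp add: u_def)
  then have "\<rho> k (- \<alpha> k + 1) * (u * (\<rho> i (s + 1) - \<rho> i s)) = \<rho> k (- \<alpha> k + 1) * (\<rho> i s / 2)"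
    by (simp add: mult_ac)
  then have "u * (\<rho> i (s + 1) - \<rho> i s) = \<rho> i s / 2"
    using k_end by (simp only: mult_cancel_left) simp
  then show "u * \<rho> i (s + 1) = (u + 1/2) * \<rho> i s"
    by (simp add: algebra_simps)
qed

lemma factor_recurrence_self:
  assumes t: "t \<in> conf_range N \<alpha> k" "t + 1 \<in> conf_range N \<alpha> k"
  defines "u \<equiv> real_of_int (t + \<alpha> k)"
  shows "u * \<rho> k (t + 1) = (u + 1/2) * \<rho> k t"
proof -
  have "\<exists>i\<in>{1..N}. i \<noteq> k"
    using N by (intro bexI[of _ "if k = 1 then 2 else 1"]) auto
  then obtain i where i: "i \<in> {1..N}" "i \<noteq> k" by blast
  define s h g where "s = - \<alpha> i" and "h = \<rho> i s" and "g = \<rho> k t"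
  define h' g' where "h' = \<rho> i (s + 1)" and "g' = \<rho> k (t + 1)"
  note s = lower_range[OF i(1), folded s_def]
  define w where "w = s + \<epsilon> i + \<alpha> k - \<epsilon> k"
  \<comment> \<open>This separates \<open>s\<close> from the zero that \<open>\<rho> i\<close> has
    at \<open>- \<alpha> k\<close> when \<open>Suc i = k\<close>.\<close>
  have "\<alpha> k \<noteq> \<alpha> i"
    using strict_antimono_on_int_gap[OF anti, of i k] strict_antimono_on_int_gap[OF anti, of k i] i k
    by (cases "i < k") auto
  then have h: "h \<noteq> 0"
    using factor_eq_0_iff[OF i(1) s(1)] i by (auto simp: h_def s_def)
  have w: "w \<noteq> 0" "w * h' = (w + 1/2) * h"
    using factor_recurrence_other[OF i s] by (auto simp: w_def h_def h'_def)
  have "(w - u) * (h' - h) * (g' - g) = (h * g' - h' * g) / 2"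
    using pair_equation(2)[OF i(1) k i(2) s t]
    by (simp add: w_def u_def h_def h'_def g_def g'_def algebra_simps)
  \<comment> \<open>The factor \<open>w\<close> makes \<open>w * h'\<close> appear, which the
    recurrence for \<open>\<rho> i\<close> replaces by \<open>(w + 1/2) * h\<close>. Then
    \<open>w\<close>, and with it the shifts, drops out.\<close>
  then have "(w - u) * (w * h' - w * h) * (g' - g) = (w * h * g' - w * h' * g) / 2"
    by algebra
  then have "h * (u * g') = h * ((u + 1/2) * g)"
    unfolding w(2) by (simp add: field_simps)
  then show ?thesis using h by (simp add: g_def g'_def)
qed

text \<open>The factor \<open>\<rho> (k - 1)\<close> steps from a nonzero value at
  \<open>- \<alpha> k - 1\<close> to zero at \<open>- \<alpha> k\<close>, so the coefficient
  \<open>u + 1/2\<close> of its recurrence must vanish there.\<close>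

lemma shift_step:
  assumes "k \<ge> 2"
  shows "\<epsilon> (k - 1) - \<epsilon> k = 1/2"
proof -
  have i: "k - 1 \<in> {1..N}" "k - 1 \<noteq> k" "Suc (k - 1) = k" using assms k by auto
  have "\<alpha> k < \<alpha> (k - 1)" using alpha_decreasing[of "k - 1"] i k by auto
  then have s: "- \<alpha> k - 1 \<in> conf_range N \<alpha> (k - 1)" "- \<alpha> k - 1 + 1 \<in> conf_range N \<alpha> (k - 1)"
    using i by (auto simp: conf_range_def)
  have "\<rho> (k - 1) (- \<alpha> k - 1) \<noteq> 0" "\<rho> (k - 1) (- \<alpha> k - 1 + 1) = 0"
    using factor_eq_0_iff[OF i(1)] s i by auto
  with factor_recurrence_other(2)[OF i(1,2) s]
  have "real_of_int (- \<alpha> k - 1) + \<epsilon> (k - 1) + \<alpha> k - \<epsilon> k + 1/2 = 0"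
    by simp
  then show ?thesis by simp
qed

section \<open>The claimed factors and comparison with the solution\<close>

definition model :: "nat \<Rightarrow> int \<Rightarrow> real" where
  "model i s = (if k \<le> i
    then discrete_sqrt (real_of_int s + real_of_int (\<alpha> k) + (real k - real i) / 2)
    else discrete_sqrt (- real_of_int s - real_of_int (\<alpha> k) - (real k - real i) / 2 + 1/2))"

lemma range_above:
  assumes "i \<in> {1..N}" "k \<le> i" "s \<in> conf_range N \<alpha> i"
  shows "real i - real k \<le> real_of_int s + real_of_int (\<alpha> k)"
proof -
  have "int i - int k \<le> s + \<alpha> k"
    using strict_antimono_on_int_gap[OF anti, of k i] assms k by (auto simp: conf_range_def)
  then have "real_of_int (int i - int k) \<le> real_of_int (s + \<alpha> k)"
    by (simp only: of_int_le_iff)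
  then show ?thesis by simp
qed

text \<open>For \<open>i < k\<close> the interval has the upper end
  \<open>- \<alpha> (i + 1)\<close>, so the gap estimate runs from \<open>Suc i\<close> to
  \<open>k\<close>; hence the extra 1.\<close>

lemma range_below:
  assumes "i \<in> {1..N}" "i < k" "s \<in> conf_range N \<alpha> i"
  shows "real_of_int s + real_of_int (\<alpha> k) \<le> real i + 1 - real k"
proof -
  have "s + \<alpha> k \<le> int i + 1 - int k"
    using strict_antimono_on_int_gap[OF anti, of "Suc i" k] assms k by (auto simp: conf_range_def)
  then have "real_of_int (s + \<alpha> k) \<le> real_of_int (int i + 1 - int k)"
    by (simp only: of_int_le_iff)
  then show ?thesis by simp
qed

lemma model_recurrence:
  assumes i: "i \<in> {1..N}" and s: "s \<in> conf_range N \<alpha> i" "s + 1 \<in> conf_range N \<alpha> i"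
  defines "u \<equiv> real_of_int s + real_of_int (\<alpha> k) + (real k - real i) / 2"
  shows "u * model i (s + 1) = (u + 1/2) * model i s"
proof (cases "k \<le> i")
  case True
  then have "u \<ge> 0" using range_above[OF i True s(1)] of_nat_mono[OF True, where ?'a = real] by (simp add: u_def field_simps)
  from discrete_sqrt_plus1[OF this] show ?thesis
    using True by (simp add: model_def u_def algebra_simps)
next
  case False
  \<comment> \<open>This reflection maps the recurrence of the discrete square root to itself with
    the roles of \<open>s\<close> and \<open>s + 1\<close> exchanged.\<close>
  define v where "v = - u - 1/2"
  have "real i + 1 \<le> real k" using False by simp
  with range_below[OF i _ s(2)] have "v \<ge> 0"
    using False by (simp add: u_def v_def field_simps)
  moreover have "model i s = discrete_sqrt (v + 1)" "model i (s + 1) = discrete_sqrt v"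
    using False by (auto simp: model_def u_def v_def intro!: arg_cong[of _ _ discrete_sqrt])
  ultimately have "v * model i s = (v + 1/2) * model i (s + 1)"
    using discrete_sqrt_plus1[of v] by simp
  then show ?thesis by (simp add: v_def algebra_simps)
qed

lemma model_base_pos:
  assumes i: "i \<in> {1..N}"
  shows "model i (base i) > 0"
proof -
  consider "i = k" | "k < i" | "i < k" by linarith
  then show ?thesis
  proof cases
    case 1
    then show ?thesis using i by (simp add: model_def base_def discrete_sqrt_pos)
  next
    case 2
    then have "real k < real i" "real i - real k \<le> real_of_int (base i) + real_of_int (\<alpha> k)"
      using range_above[OF i _ base_range[OF i]] by simp_all
    then have "real_of_int (base i) + real_of_int (\<alpha> k) + (real k - real i) / 2 > 0"
      by (simp add: field_simps)
    then show ?thesis using 2 by (simp add: model_def discrete_sqrt_pos)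
  next
    case 3
    \<comment> \<open>The bound at \<open>base i\<close> itself would still allow argument 0 when
      \<open>i = k - 1\<close>; using the next point gains one unit.\<close>
    have "base i + 1 \<in> conf_range N \<alpha> i"
      using lower_range(2)[OF i] 3 i by (simp add: base_def)
    from range_below[OF i 3 this]
    have "- real_of_int (base i) - real_of_int (\<alpha> k) - (real k - real i) / 2 + 1/2 > 0"
      using 3 by (simp add: field_simps)
    then show ?thesis using 3 by (simp add: model_def discrete_sqrt_pos)
  qed
qed

text \<open>From \<open>base i\<close> upwards both functions satisfy the same recurrence. The only
  point below is \<open>- \<alpha> k\<close> for \<open>i = k\<close>, where both vanish.\<close>

lemma factor_eq_model:
  assumes eps: "\<And>i. i \<in> {1..N} \<Longrightarrow> \<epsilon> i - \<epsilon> k = (real k - real i) / 2"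
    and i: "i \<in> {1..N}" and s: "s \<in> conf_range N \<alpha> i"
  shows "\<rho> i s = \<rho> i (base i) / model i (base i) * model i s"
proof (cases "base i \<le> s")
  case True
  define u where "u t = real_of_int t + real_of_int (\<alpha> k) + (real k - real i) / 2" for t
  have rng: "t \<in> conf_range N \<alpha> i" "t + 1 \<in> conf_range N \<alpha> i" if "base i \<le> t" "t < s" for t
    using that s base_range[OF i] by (auto simp: conf_range_def)
  \<comment> \<open>For \<open>i = k\<close> the coefficient is at least 1 because
    \<open>base k = - \<alpha> k + 1\<close>; for other \<open>i\<close> it is a denominator of the
    system.\<close>
  have *: "u t \<noteq> 0 \<and> u t * \<rho> i (t + 1) = (u t + 1/2) * \<rho> i t" if t: "base i \<le> t" "t < s" for t
  proof (cases "i = k")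
    case True
    then show ?thesis
      using factor_recurrence_self[of t] rng[OF t] t i by (simp add: u_def base_def)
  next
    case False
    have "real_of_int t + \<epsilon> i + real_of_int (\<alpha> k) - \<epsilon> k = u t"
      using eps[OF i] by (simp add: u_def)
    then show ?thesis
      using factor_recurrence_other[OF i False rng[OF t]] by simp
  qed
  show ?thesis
  proof (rule first_order_recurrence_unique[where p = u and q = "\<lambda>t. u t + 1/2"])
    show "u t * model i (t + 1) = (u t + 1/2) * model i t" if "base i \<le> t" "t < s" for t
      using model_recurrence[OF i rng[OF that]] by (simp add: u_def)
  qed (use True * model_base_pos[OF i] in auto)
next
  case False
  then have "i = k" "s = - \<alpha> k"
    using s i by (auto simp: base_def conf_range_def split: if_splits)
  then show ?thesis
    using factor_eq_0_iff[OF i s] by (simp add: model_def discrete_sqrt_def)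
qed

lemma solution_eq_model:
  assumes eps: "\<And>i. i \<in> {1..N} \<Longrightarrow> \<epsilon> i - \<epsilon> k = (real k - real i) / 2"
  shows "\<exists>D>0. \<forall>n\<in>conf_domain N \<alpha>. y n = D * (\<Prod>i=1..N.
    if k \<le> i
    then discrete_sqrt (real_of_int (n i) + real_of_int (\<alpha> k) + (real k - real i) / 2)
    else discrete_sqrt (- real_of_int (n i) - real_of_int (\<alpha> k) - (real k - real i) / 2 + 1/2))"
proof -
  define D where "D = (\<Prod>i=1..N. \<rho> i (base i) / model i (base i))"
  have "y n = D * (\<Prod>i=1..N. model i (n i))" if n: "n \<in> conf_domain N \<alpha>" for n
  proof -
    have "y n = (\<Prod>i=1..N. \<rho> i (base i) / model i (base i) * model i (n i))"
      unfolding sep[OF n] using n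
      by (intro prod.cong factor_eq_model eps) (auto simp: conf_domain_iff)
    then show ?thesis by (simp only: D_def prod.distrib)
  qed
  \<comment> \<open>Single ratios may be negative, but the numerators multiply to
    \<open>y base > 0\<close> and all denominators are positive.\<close>
  moreover have "D > 0"
    using pos[OF base_in base_not_boundary] sep[OF base_in] prod_pos[of "{1..N}" "\<lambda>i. model i (base i)"]
      model_base_pos by (auto simp: D_def prod_dividef)
  ultimately show ?thesis unfolding model_def by blast
qed

end

section \<open>Telescoping the shifts and collecting the constants\<close>

theorem proposition6p2:
  fixes N :: nat and \<alpha> :: "nat \<Rightarrow> int" and \<epsilon> :: "nat \<Rightarrow> real"
    and x :: "nat \<Rightarrow> (nat \<Rightarrow> int) \<Rightarrow> real"
  assumes "N \<ge> 2"
    and "strict_antimono_on {1..N} \<alpha>"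
    and "\<forall>k\<in>{1..N}. \<forall>n\<in>conf_domain N \<alpha>. x k n \<ge> 0"
    and "lin_indep_on N (conf_domain N \<alpha>) x"
    and "\<forall>k\<in>{1..N}. separable_on N (conf_domain N \<alpha>) (x k)"
    and "\<forall>k\<in>{1..N}. discrete_EPD N (conf_domain N \<alpha>) (1/2) \<epsilon> (x k)"
    and "\<forall>k\<in>{1..N}. \<forall>n\<in>conf_domain N \<alpha>. conf_boundary \<alpha> k n \<longrightarrow> x k n = 0"
    and "\<forall>k\<in>{1..N}. \<forall>n\<in>conf_domain N \<alpha>. \<not> conf_boundary \<alpha> k n \<longrightarrow> x k n > 0"
  shows "(\<forall>i\<in>{1..N}. \<forall>j\<in>{1..N}. \<epsilon> i - \<epsilon> j = (real j - real i) / 2) \<and>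
    (\<exists>D :: nat \<Rightarrow> real. (\<forall>k\<in>{1..N}. D k > 0) \<and>
      (\<forall>k\<in>{1..N}. \<forall>n\<in>conf_domain N \<alpha>.
        x k n = D k * (\<Prod>i=1..N.
          if k \<le> i
          then discrete_sqrt (real_of_int (n i) + real_of_int (\<alpha> k) + (real k - real i) / 2)
          else discrete_sqrt (- real_of_int (n i) - real_of_int (\<alpha> k)
                              - (real k - real i) / 2 + 1/2))))"
proof -
  have sol: "\<exists>\<rho>. separable_EPD_solution N \<alpha> \<epsilon> k (x k) \<rho>" if "k \<in> {1..N}" for k
  proof -
    obtain \<rho> where "\<forall>n\<in>conf_domain N \<alpha>. x k n = (\<Prod>i=1..N. \<rho> i (n i))"
      using assms(5) \<open>k \<in> {1..N}\<close> unfolding separable_on_def by blast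
    then have "separable_EPD_solution N \<alpha> \<epsilon> k (x k) \<rho>"
      using assms \<open>k \<in> {1..N}\<close> by unfold_locales blast+
    then show ?thesis by blast
  qed
  \<comment> \<open>The solutions share their shifts, so the one with index \<open>Suc i\<close>
    supplies the difference of the neighbouring shifts \<open>\<epsilon> i\<close> and
    \<open>\<epsilon> (Suc i)\<close>.\<close>
  have eps_Suc: "\<epsilon> i - \<epsilon> (Suc i) = 1/2" if "1 \<le> i" "Suc i \<le> N" for i
    using sol[of "Suc i"] separable_EPD_solution.shift_step[of N \<alpha> \<epsilon> "Suc i"] that by fastforce
  have first: "\<epsilon> 1 - \<epsilon> i = (real i - 1) / 2" if "1 \<le> i" "i \<le> N" for i
    using that
  proof (induction i rule: dec_induct)
    case (step j)
    then show ?case using eps_Suc[of j] by simp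
  qed simp
  have eps: "\<epsilon> i - \<epsilon> j = (real j - real i) / 2" if "i \<in> {1..N}" "j \<in> {1..N}" for i j
    using first[of i] first[of j] that by (simp add: field_simps)
  have "\<forall>k\<in>{1..N}. \<exists>D>0. \<forall>n\<in>conf_domain N \<alpha>. x k n = D * (\<Prod>i=1..N.
    if k \<le> i
    then discrete_sqrt (real_of_int (n i) + real_of_int (\<alpha> k) + (real k - real i) / 2)
    else discrete_sqrt (- real_of_int (n i) - real_of_int (\<alpha> k) - (real k - real i) / 2 + 1/2))"
    using sol separable_EPD_solution.solution_eq_model eps by blast
  then show ?thesis
    using eps by (simp only: bchoice_iff Bex_def) (blast dest!: bchoice)
qed

end
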